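(* Let $n \geq 3$ be a natural number. The perimeter $L(P)$ of any convex polygon $P$ in the Euclidean plane with $n$ vertices that satisfies the $\Delta$ property satisfies $L(P)\geq 3$. Moreover, this inequality cannot be improved (that is, for each $n\ge 3$ and every $\varepsilon>0$ there is a convex polygon $P$ with $n$ vertices that satisfies the $\Delta$ property and has $L(P)<3+\varepsilon$), while the equality $L(P)=3$ holds if and only if $P$ is a regular triangle with unit side.
   Context: The Euclidean plane is $\mathbb{R}^2$ with the standard Euclidean metric $d$. A convex polygon is the convex hull of a finite set of points in $\mathbb{R}^2$; $L(P)$ denotes its perimeter. A convex polygon $P$ has the $\Delta$ property if for the endpoints $A$ and $B$ of every side of $P$ there is a point $C\in P$ (not necessarily a vertex of $P$) such that $d(A,C)=d(B,C)=1$. *)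

theory Defs
  imports "HOL-Analysis.Analysis"
begin

type_synonym plane = "real ^ 2"

abbreviation convex_polygon :: "plane set \<Rightarrow> bool" where
  "convex_polygon P \<equiv> polytope P"

definition vertices :: "plane set \<Rightarrow> plane set" where
  "vertices P = {v. v extreme_point_of P}"

text \<open>Since \<open>edge_of\<close> requires affine dimension 1, the endpoints of a side are distinct.\<close>

definition side_endpoints :: "plane set \<Rightarrow> plane \<Rightarrow> plane \<Rightarrow> bool" where
  "side_endpoints P A B \<longleftrightarrow> closed_segment A B edge_of P"

text \<open>A side is a segment, so its diameter is its length (see \<open>diameter_segment\<close>). A polygon has
  only finitely many faces, so the sum is never the default value 0 of an infinite sum. When
  \<open>P\<close> degenerates to a segment, which has only two vertices, this definition counts
  its length once.\<close>

definition perimeter :: "plane set \<Rightarrow> real" where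
  "perimeter P = (\<Sum>e | e edge_of P. diameter e)"

definition Delta_property :: "plane set \<Rightarrow> bool" where
  "Delta_property P \<longleftrightarrow>
     (\<forall>A B. side_endpoints P A B \<longrightarrow> (\<exists>C\<in>P. dist A C = 1 \<and> dist B C = 1))"

definition unit_regular_triangle :: "plane set \<Rightarrow> bool" where
  "unit_regular_triangle P \<longleftrightarrow>
     (\<exists>A B C. P = convex hull {A, B, C} \<and> dist A B = 1 \<and> dist B C = 1 \<and> dist C A = 1)"

lemma diameter_segment: "diameter (closed_segment a b) = dist a b" for a b :: plane
proof (rule antisym)
  show "diameter (closed_segment a b) \<le> dist a b"
  proof (rule diameter_le)
    fix x y assume x: "x \<in> closed_segment a b" and y: "y \<in> closed_segment a b"
    have "dist x y \<le> dist x a \<or> dist x y \<le> dist x b"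
      using dist_decreases_closed_segment[OF y, of x] by auto
    moreover have "dist x a \<le> dist a b" "dist x b \<le> dist a b"
      using dist_in_closed_segment[OF x] by auto
    ultimately show "norm (x - y) \<le> dist a b"
      by (auto simp: dist_norm)
  qed simp
  show "dist a b \<le> diameter (closed_segment a b)"
    by (rule diameter_bounded_bound) (auto intro: bounded_closed_segment)
qed

lemma finite_sides: "convex_polygon P \<Longrightarrow> finite {e. e edge_of P}"
  by (rule finite_subset[OF _ finite_polytope_faces[of P]]) (auto simp: edge_of_def)

end

theory Submission
  imports Defs
begin

text \<open>
  The proof measures a polygon by its widths. By Cauchy's formula the perimeter of a convex polygon
  is the integral of its width over a half turn of directions; the lower
  bound rests on the inequality \<open>perimeter_ge_integral_width\<close>.

  Let \<open>P\<close> have the \<open>\<Delta>\<close> property. If some side \<open>AB\<close> has length at least 1, then \<open>P\<close> contains the triangle of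
  \<open>A\<close>, \<open>B\<close> and the apex \<open>C\<close>, whose perimeter is at least 3. Since \<open>P\<close> is at least as wide as the triangle
  in every direction, the perimeter of \<open>P\<close> is at least 3 (\<open>perimeter_ge_triangle\<close>), with
  equality only if \<open>P\<close> is this triangle and \<open>AB\<close> has length 1 (\<open>perimeter_gt_triangle\<close>).

  Now let all sides be shorter than 1. The unit vectors from the endpoints of a side to its apex point
  in two directions, at an angle \<open>\<alpha> < pi / 6\<close> to the left and to the right of a normal of the side. These
  directions, for all sides and up to sign, cut the half turn into intervals, and on each of them the
  average width exceeds \<open>3 / pi\<close> (\<open>integral_width_gap\<close>). If the interval is shorter than \<open>pi / 3\<close>, this
  follows from the unit vectors at its ends alone, because the sine is concave. Otherwise
  the width is at least 1 throughout: a smaller width would have a local minimum in the interval,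
  a local minimum of the width occurs at a normal of a side
  (\<open>local_min_of_width_is_edge_normal\<close>), and the two directions belonging to that side
  would force the interval to be shorter than \<open>pi / 3\<close>. Adding up the intervals shows that the perimeter
  is greater than 3.

  For the sharpness, the convex hull of the centre of a unit circle and of points on an arc of sixty
  degrees, both ends of the arc included, has the \<open>\<Delta>\<close> property. Its perimeter tends to 3 when all the
  points but one end cluster at the other end (\<open>perimeter_sector_le\<close>).
\<close>

section \<open>Sides and width of a polygon\<close>

lemma edge_is_segment:
  assumes "polytope P" "e edge_of P"
  obtains A B where "e = closed_segment A B" "A \<noteq> B" "A \<in> vertices P" "B \<in> vertices P"
proof -
  have face: "e face_of P" and dim: "aff_dim e = 1"
    using assms(2) by (auto simp: edge_of_def)
  have "polytope e" using assms(1) face by (rule face_of_polytope_polytope)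
  moreover have "e \<noteq> {}" using dim by auto
  moreover have "collinear e" using dim by (simp add: collinear_aff_dim)
  ultimately obtain A B where AB: "e = closed_segment A B"
    by (metis compact_convex_collinear_segment polytope_imp_compact polytope_imp_convex)
  have "A \<noteq> B" using dim AB by auto
  moreover have "A \<in> vertices P" "B \<in> vertices P"
    using segment_face_of[of A B P] face AB by (auto simp: vertices_def face_of_singleton)
  ultimately show thesis using that AB by blast
qed

text \<open>The set \<open>V\<close> stands for its convex hull: a linear function takes its extreme values on the hull at
points of \<open>V\<close>, and a maximum over a finite set makes continuity in \<open>u\<close> immediate.\<close>

definition width :: "plane set \<Rightarrow> plane \<Rightarrow> real" where
  "width V u = Max ((\<lambda>(x, y). (x - y) \<bullet> u) ` (V \<times> V))"

lemma width_attained: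
  assumes "finite V" "V \<noteq> {}"
  obtains x y where "x \<in> V" "y \<in> V" "width V u = (x - y) \<bullet> u"
proof -
  have "width V u \<in> (\<lambda>(x, y). (x - y) \<bullet> u) ` (V \<times> V)"
    unfolding width_def using assms by (intro Max_in) auto
  then show thesis using that by auto
qed

lemma width_ge:
  assumes "finite V" "x \<in> convex hull V" "y \<in> convex hull V"
  shows "(x - y) \<bullet> u \<le> width V u"
proof -
  have *: "(p - q) \<bullet> u \<le> width V u" if "p \<in> V" "q \<in> V" for p q
    unfolding width_def using assms(1) that by (intro Max_ge) auto
  have "convex hull V \<subseteq> {p. u \<bullet> p \<le> width V u + u \<bullet> q}" if "q \<in> V" for q
  proof (intro hull_minimal convex_halfspace_le subsetI CollectI)
    show "u \<bullet> p \<le> width V u + u \<bullet> q" if "p \<in> V" for p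
      using *[OF that \<open>q \<in> V\<close>] by (simp add: inner_diff_left inner_commute[of u])
  qed
  then have "V \<subseteq> {q. u \<bullet> q \<ge> u \<bullet> x - width V u}" using assms(2) by force
  then have "convex hull V \<subseteq> {q. u \<bullet> q \<ge> u \<bullet> x - width V u}"
    by (intro hull_minimal convex_halfspace_ge)
  then have "u \<bullet> y \<ge> u \<bullet> x - width V u" using assms(3) by auto
  then show ?thesis by (simp add: inner_diff_left inner_commute[of u])
qed

section \<open>Cauchy's inequality between width and perimeter\<close>

text \<open>The line leaves the polygon at one frontier point on either side of \<open>z\<close>. These two points cannot lie
on a common side, since \<open>z\<close> would then lie on that side by convexity, hence on the frontier.\<close>

lemma line_meets_two_edges:
  fixes P :: "plane set"
  assumes "polytope P" "z \<in> interior P" "v \<noteq> 0"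
  obtains e e' s s' where "e edge_of P" "e' edge_of P" "e \<noteq> e'"
    "z + s *\<^sub>R v \<in> e" "z + s' *\<^sub>R v \<in> e'"
proof -
  have ne: "interior P \<noteq> {}" using assms by auto
  have "aff_dim P = 2" using aff_dim_nonempty_interior[OF ne] by simp
  then have union: "frontier P = \<Union> {e. e edge_of P}"
    using rel_frontier_of_polyhedron[OF polytope_imp_polyhedron[OF assms(1)]]
      rel_frontier_nonempty_interior[OF ne]
    by (auto simp: facet_of_def edge_of_def)
  have bnd: "bounded P" using assms(1) by (rule polytope_imp_bounded)
  obtain s where s: "0 < s" "z + s *\<^sub>R v \<in> frontier P"
    using ray_to_frontier[OF bnd assms(2,3)] by blast
  obtain t where t: "0 < t" "z + t *\<^sub>R (- v) \<in> frontier P"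
    using ray_to_frontier[OF bnd assms(2), of "- v"] assms(3) by auto
  obtain e where e: "e edge_of P" "z + s *\<^sub>R v \<in> e" using s union by auto
  obtain e' where e': "e' edge_of P" "z + (- t) *\<^sub>R v \<in> e'" using t union by auto
  have "e \<noteq> e'"
  proof
    assume "e = e'"
    then have "closed_segment (z + s *\<^sub>R v) (z + (- t) *\<^sub>R v) \<subseteq> e"
      using e e' by (metis closed_segment_subset edge_of_def face_of_imp_convex)
    moreover have "z \<in> closed_segment (z + s *\<^sub>R v) (z + (- t) *\<^sub>R v)"
    proof -
      define r where "r = s / (s + t)"
      have "(1 - r) * s - r * t = 0" using s t by (simp add: r_def field_simps)
      then have "z = z + ((1 - r) * s - r * t) *\<^sub>R v" by simp
      also have "\<dots> = (1 - r) *\<^sub>R (z + s *\<^sub>R v) + r *\<^sub>R (z + (- t) *\<^sub>R v)"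
        by (simp add: algebra_simps)
      finally have "z = \<dots>" .
      moreover have "0 \<le> r" "r \<le> 1" using s t by (auto simp: r_def)
      ultimately show ?thesis unfolding in_segment by blast
    qed
    ultimately have "z \<in> frontier P" using e union by auto
    then show False using assms(2) by (simp add: frontier_def)
  qed
  then show thesis using that e e' by blast
qed

text \<open>The sides, projected to the direction \<open>u\<close>, cover the projection of the polygon twice: every line
orthogonal to \<open>u\<close> that passes through the interior meets two different sides. Integrating the
number of projected sides over the position of the line gives the inequality.\<close>

lemma two_width_le_sum_projections:
  fixes V :: "plane set"
  defines "P \<equiv> convex hull V"
  assumes V: "finite V" and ne: "interior P \<noteq> {}"
    and seg: "\<And>e. e edge_of P \<Longrightarrow> e = closed_segment (a e) (b e)"
  shows "2 * width V u \<le> (\<Sum>e | e edge_of P. \<bar>(a e - b e) \<bullet> u\<bar>)"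
proof -
  let ?E = "{e. e edge_of P}"
  have poly: "polytope P" using V by (auto simp: P_def polytope_def)
  have "V \<noteq> {}" using ne by (auto simp: P_def)
  then obtain x y where xy: "x \<in> V" "y \<in> V" "width V u = (x - y) \<bullet> u"
    using width_attained V by metis
  have fin: "finite ?E" by (rule finite_sides[OF poly])
  let ?I = "\<lambda>e. {min (u \<bullet> a e) (u \<bullet> b e) .. max (u \<bullet> a e) (u \<bullet> b e)}"
  have I: "u \<bullet> q \<in> ?I e" if edge: "e edge_of P" "q \<in> e" for e q
  proof -
    obtain r where r: "0 \<le> r" "r \<le> 1" "q = (1 - r) *\<^sub>R a e + r *\<^sub>R b e"
      using seg[OF edge(1)] edge(2) by (metis in_segment(1))
    have "u \<bullet> q \<in> closed_segment (u \<bullet> a e) (u \<bullet> b e)"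
      unfolding in_segment using r by (intro exI[of _ r]) (auto simp: inner_add_right)
    then show ?thesis by (auto simp: closed_segment_eq_real_ivl split: if_splits)
  qed
  have two: "2 \<le> (\<Sum>e\<in>?E. indicat_real (?I e) t)" if t: "u \<bullet> y < t" "t < u \<bullet> x" for t
  proof -
    have cl: "closure (interior P) = P"
      using convex_closure_interior[of P] ne polytope_imp_convex[OF poly]
        polytope_imp_closed[OF poly] by simp
    have xP: "x \<in> P" "y \<in> P" using xy by (auto simp: P_def hull_inc)
    have "{p. u \<bullet> p > t} \<inter> interior P \<noteq> {}"
      using open_Int_closure_eq_empty[OF open_halfspace_gt, of t u "interior P"] cl xP t by auto
    then obtain x' where x': "x' \<in> interior P" "u \<bullet> x' > t" by auto
    have "{p. u \<bullet> p < t} \<inter> interior P \<noteq> {}"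
      using open_Int_closure_eq_empty[OF open_halfspace_lt, of u t "interior P"] cl xP t by auto
    then obtain y' where y': "y' \<in> interior P" "u \<bullet> y' < t" by auto
    have "connected (interior P)"
      by (simp add: convex_connected convex_interior poly polytope_imp_convex)
    then obtain z where z: "z \<in> interior P" "u \<bullet> z = t"
      using connected_ivt_hyperplane[of "interior P" y' x' u t] x' y' by auto
    \<comment> \<open>\<open>v\<close> is \<open>u\<close> turned by a right angle, so it spans the level line of \<open>u\<close> through \<open>z\<close>.\<close>
    define v :: plane where "v = vector [- (u $ 2), u $ 1]"
    have uv: "u \<bullet> v = 0" by (simp add: v_def inner_vec_def sum_2)
    have "u \<noteq> 0" using t by auto
    then have "v \<noteq> 0" by (auto simp: v_def vec_eq_iff forall_2)
    then obtain e e' s s' where e: "e edge_of P" "e' edge_of P" "e \<noteq> e'"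
      "z + s *\<^sub>R v \<in> e" "z + s' *\<^sub>R v \<in> e'"
      using line_meets_two_edges[OF poly z(1)] by metis
    have "t \<in> ?I e" "t \<in> ?I e'"
      using I[OF e(1,4)] I[OF e(2,5)] z uv by (auto simp: inner_add_right)
    then have "2 = (\<Sum>e\<in>{e, e'}. indicat_real (?I e) t)"
      using e(3) by (simp add: indicator_def)
    also have "\<dots> \<le> (\<Sum>e\<in>?E. indicat_real (?I e) t)"
      using e fin by (intro sum_mono2) auto
    finally show ?thesis .
  qed
  show ?thesis
  proof (cases "u \<bullet> y < u \<bullet> x")
    case True
    have "2 * width V u = (LINT t|lborel. 2 * indicat_real {u \<bullet> y <..< u \<bullet> x} t)"
      using True xy by (simp add: inner_diff_left inner_diff_right inner_commute)
    also have "\<dots> \<le> (LINT t|lborel. (\<Sum>e\<in>?E. indicat_real (?I e) t))"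
    proof (intro integral_mono)
      fix t
      show "2 * indicat_real {u \<bullet> y <..< u \<bullet> x} t \<le> (\<Sum>e\<in>?E. indicat_real (?I e) t)"
        using two[of t] by (auto simp: indicator_def intro!: sum_nonneg)
    qed (use True in \<open>auto intro!: integrable_real_indicator\<close>)
    also have "\<dots> = (\<Sum>e\<in>?E. (LINT t|lborel. indicat_real (?I e) t))"
      by (intro Bochner_Integration.integral_sum) auto
    also have "\<dots> = (\<Sum>e\<in>?E. \<bar>(a e - b e) \<bullet> u\<bar>)"
      by (intro sum.cong) (auto simp: inner_diff_left inner_diff_right inner_commute)
    finally show ?thesis .
  next
    case False
    then have "2 * width V u \<le> 0" using xy by (simp add: inner_diff_left inner_diff_right inner_commute)
    then show ?thesis by (smt (verit) sum_nonneg abs_ge_zero)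
  qed
qed

definition dir :: "real \<Rightarrow> plane" where
  "dir \<theta> = vector [cos \<theta>, sin \<theta>]"

lemma inner_dir: "v \<bullet> dir \<theta> = v $ 1 * cos \<theta> + v $ 2 * sin \<theta>"
  by (simp add: dir_def inner_vec_def sum_2)

lemma inner_dir_dir: "dir \<alpha> \<bullet> dir \<beta> = cos (\<alpha> - \<beta>)"
  by (simp add: dir_def inner_vec_def sum_2 cos_diff)

lemma dir_plus_pi: "dir (\<theta> + pi) = - dir \<theta>"
  by (simp add: dir_def vec_eq_iff forall_2)

lemma norm_dir [simp]: "norm (dir \<theta>) = 1"
  by (simp add: norm_eq_1 inner_dir_dir)

lemma dir_nonzero [simp]: "dir \<theta> \<noteq> 0"
  by (metis norm_dir norm_zero zero_neq_one)

lemma unit_vector_is_dir: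
  assumes "norm (x :: plane) = 1"
  obtains \<theta> where "x = dir \<theta>"
proof -
  have "(x $ 1)\<^sup>2 + (x $ 2)\<^sup>2 = 1"
    using assms by (simp add: norm_eq_1 inner_vec_def sum_2 power2_eq_square)
  then obtain \<theta> where "x $ 1 = cos \<theta>" "x $ 2 = sin \<theta>" using sincos_total_2pi by metis
  then show thesis using that by (simp add: dir_def vec_eq_iff forall_2)
qed

lemma continuous_on_inner_dir: "continuous_on S (\<lambda>\<theta>. v \<bullet> dir \<theta>)"
  unfolding inner_dir by (intro continuous_intros)

lemma continuous_on_dir [continuous_intros]: "continuous_on S dir"
  using continuous_on_inner_dir
  by (subst continuous_on_componentwise) (simp add: inner_commute[of "dir _"])

text \<open>Up to a sign, \<open>v \<bullet> dir \<theta>\<close> is \<open>norm v\<close> times the sine of the angle from a direction orthogonal to \<open>v\<close>,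
and the absolute value of the sine has integral 2 over a half turn. The starting angle \<open>s\<close> is kept
arbitrary so that later arguments can begin at an angle of their choice.\<close>

lemma integral_abs_inner_dir:
  "((\<lambda>\<theta>. \<bar>v \<bullet> dir \<theta>\<bar>) has_integral 2 * norm v) {s .. s + pi}"
proof -
  \<comment> \<open>A half turn reverses \<open>dir\<close>, so \<open>v \<bullet> dir \<theta>\<close> changes sign on the interval and has a zero \<open>\<psi>\<close>.\<close>
  have "\<exists>\<psi>. s \<le> \<psi> \<and> \<psi> \<le> s + pi \<and> v \<bullet> dir \<psi> = 0"
  proof (cases "v \<bullet> dir s \<le> 0")
    case True
    then show ?thesis using IVT'[of "\<lambda>\<theta>. v \<bullet> dir \<theta>" s 0 "s + pi"]
      by (simp add: dir_plus_pi continuous_on_inner_dir)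
  next
    case False
    then show ?thesis using IVT2'[of "\<lambda>\<theta>. v \<bullet> dir \<theta>" "s + pi" 0 s]
      by (simp add: dir_plus_pi continuous_on_inner_dir)
  qed
  then obtain \<psi> where \<psi>: "s \<le> \<psi>" "\<psi> \<le> s + pi" "v \<bullet> dir \<psi> = 0" by blast
  define c where "c = v \<bullet> dir (\<psi> + pi / 2)"
  have orth: "v $ 1 * cos \<psi> + v $ 2 * sin \<psi> = 0" using \<psi>(3) by (simp add: inner_dir)
  have c: "c = v $ 2 * cos \<psi> - v $ 1 * sin \<psi>" by (simp add: c_def inner_dir cos_add sin_add)
  have v1: "v $ 1 = - c * sin \<psi>" and v2: "v $ 2 = c * cos \<psi>"
    using orth c sin_cos_squared_add[of \<psi>] by algebra+
  have "(norm v)\<^sup>2 = c\<^sup>2 * ((sin \<psi>)\<^sup>2 + (cos \<psi>)\<^sup>2)"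
    by (simp only: power2_norm_eq_inner inner_vec_def sum_2 v1 v2 inner_real_def)
       (simp only: power2_eq_square algebra_simps minus_mult_minus)
  then have "(norm v)\<^sup>2 = c\<^sup>2" by simp
  then have nv: "norm v = \<bar>c\<bar>" by (metis abs_norm_cancel real_sqrt_abs)
  have val: "v \<bullet> dir \<theta> = c * sin (\<theta> - \<psi>)" for \<theta>
    by (simp add: inner_dir v1 v2 sin_diff algebra_simps)
  have 1: "((\<lambda>\<theta>. \<bar>c\<bar> * sin (\<psi> - \<theta>)) has_integral (\<bar>c\<bar> * cos (\<psi> - \<psi>) - \<bar>c\<bar> * cos (\<psi> - s))) {s .. \<psi>}"
    by (rule fundamental_theorem_of_calculus[OF \<psi>(1)])
       (auto intro!: derivative_eq_intros simp flip: has_real_derivative_iff_has_vector_derivative)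
  have 2: "((\<lambda>\<theta>. \<bar>c\<bar> * sin (\<theta> - \<psi>)) has_integral
      (- \<bar>c\<bar> * cos (s + pi - \<psi>) - (- \<bar>c\<bar> * cos (\<psi> - \<psi>)))) {\<psi> .. s + pi}"
    by (rule fundamental_theorem_of_calculus[OF \<psi>(2)])
       (auto intro!: derivative_eq_intros simp flip: has_real_derivative_iff_has_vector_derivative)
  have left: "((\<lambda>\<theta>. \<bar>v \<bullet> dir \<theta>\<bar>) has_integral (\<bar>c\<bar> * cos (\<psi> - \<psi>) - \<bar>c\<bar> * cos (\<psi> - s))) {s .. \<psi>}"
  proof (rule has_integral_eq[OF _ 1])
    fix \<theta> assume "\<theta> \<in> {s..\<psi>}"
    then have "sin (\<psi> - \<theta>) \<ge> 0" using \<psi> by (intro sin_ge_zero) auto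
    moreover have "sin (\<theta> - \<psi>) = - sin (\<psi> - \<theta>)" by (metis minus_diff_eq sin_minus)
    ultimately show "\<bar>c\<bar> * sin (\<psi> - \<theta>) = \<bar>v \<bullet> dir \<theta>\<bar>" by (simp add: val abs_mult)
  qed
  have right: "((\<lambda>\<theta>. \<bar>v \<bullet> dir \<theta>\<bar>) has_integral
      (- \<bar>c\<bar> * cos (s + pi - \<psi>) - (- \<bar>c\<bar> * cos (\<psi> - \<psi>)))) {\<psi> .. s + pi}"
  proof (rule has_integral_eq[OF _ 2])
    fix \<theta> assume "\<theta> \<in> {\<psi>..s + pi}"
    then have "sin (\<theta> - \<psi>) \<ge> 0" using \<psi> by (intro sin_ge_zero) auto
    then show "\<bar>c\<bar> * sin (\<theta> - \<psi>) = \<bar>v \<bullet> dir \<theta>\<bar>" by (simp add: val abs_mult)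
  qed
  have "cos (s + pi - \<psi>) = - cos (\<psi> - s)"
    by (metis add.commute add_diff_eq cos_minus cos_periodic_pi2 minus_diff_eq)
  then show ?thesis
    using has_integral_combine[OF \<psi>(1,2) left right] by (simp add: nv)
qed

lemma continuous_on_Max:
  fixes f :: "'i \<Rightarrow> 'a::topological_space \<Rightarrow> real"
  assumes "finite I" "I \<noteq> {}" "\<And>i. i \<in> I \<Longrightarrow> continuous_on S (f i)"
  shows "continuous_on S (\<lambda>x. Max ((\<lambda>i. f i x) ` I))"
  using assms
proof (induction I rule: finite_ne_induct)
  case (insert i I)
  then have "continuous_on S (\<lambda>x. max (f i x) (Max ((\<lambda>i. f i x) ` I)))"
    by (intro continuous_intros) auto
  then show ?case using insert by simp
qed auto

lemma continuous_on_width: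
  assumes "finite V" "V \<noteq> {}"
  shows "continuous_on S (\<lambda>\<theta>. width V (dir \<theta>))"
proof -
  have "continuous_on S (\<lambda>\<theta>. Max ((\<lambda>p. (fst p - snd p) \<bullet> dir \<theta>) ` (V \<times> V)))"
    using assms by (intro continuous_on_Max continuous_on_inner_dir) auto
  then show ?thesis by (simp add: width_def case_prod_unfold)
qed

text \<open>This is one half of Cauchy's formula, which states equality: average the bound on projections over
all directions.\<close>

lemma perimeter_ge_integral_width:
  fixes V :: "plane set"
  assumes V: "finite V" and ne: "interior (convex hull V) \<noteq> {}"
  shows "integral {s .. s + pi} (\<lambda>\<theta>. width V (dir \<theta>)) \<le> perimeter (convex hull V)"
proof -
  let ?P = "convex hull V"
  let ?E = "{e. e edge_of ?P}"
  have poly: "polytope ?P" using V by (auto simp: polytope_def)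
  have V0: "V \<noteq> {}" using ne by auto
  have "\<forall>e. \<exists>A B. e edge_of ?P \<longrightarrow> e = closed_segment A B"
    by (metis edge_is_segment[OF poly])
  then obtain a b where seg: "\<And>e. e edge_of ?P \<Longrightarrow> e = closed_segment (a e) (b e)"
    by metis
  have int: "((\<lambda>\<theta>. \<Sum>e\<in>?E. \<bar>(a e - b e) \<bullet> dir \<theta>\<bar> / 2) has_integral
      (\<Sum>e\<in>?E. 2 * norm (a e - b e) / 2)) {s .. s + pi}"
    by (intro has_integral_sum finite_sides[OF poly] has_integral_divide integral_abs_inner_dir)
  have "integral {s .. s + pi} (\<lambda>\<theta>. width V (dir \<theta>))
      \<le> integral {s .. s + pi} (\<lambda>\<theta>. \<Sum>e\<in>?E. \<bar>(a e - b e) \<bullet> dir \<theta>\<bar> / 2)"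
  proof (intro integral_le)
    show "(\<lambda>\<theta>. width V (dir \<theta>)) integrable_on {s..s + pi}"
      by (intro integrable_continuous_real continuous_on_width V V0)
    show "width V (dir \<theta>) \<le> (\<Sum>e\<in>?E. \<bar>(a e - b e) \<bullet> dir \<theta>\<bar> / 2)" for \<theta>
      using two_width_le_sum_projections[OF V ne seg, of "dir \<theta>"]
      by (simp flip: sum_divide_distrib)
  qed (use int in blast)
  also have "\<dots> = (\<Sum>e\<in>?E. norm (a e - b e))" using integral_unique[OF int] by simp
  also have "\<dots> = perimeter ?P"
    unfolding perimeter_def
    by (intro sum.cong) (metis diameter_segment dist_norm mem_Collect_eq seg)+
  finally show ?thesis .
qed

section \<open>Triangles contained in a polygon\<close>

text \<open>The spread of three reals is half the sum of their mutual distances, so the left-hand side is the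
width of the triangle.\<close>

lemma width_ge_triangle:
  assumes "finite V" "{A, B, C} \<subseteq> convex hull V"
  shows "(\<bar>(A - B) \<bullet> u\<bar> + \<bar>(B - C) \<bullet> u\<bar> + \<bar>(C - A) \<bullet> u\<bar>) / 2 \<le> width V u"
proof -
  have "(x - y) \<bullet> u \<le> width V u" if "x \<in> {A, B, C}" "y \<in> {A, B, C}" for x y
    using width_ge assms that by blast
  then have "(A - B) \<bullet> u \<le> width V u" "(B - A) \<bullet> u \<le> width V u" "(B - C) \<bullet> u \<le> width V u"
    "(C - B) \<bullet> u \<le> width V u" "(C - A) \<bullet> u \<le> width V u" "(A - C) \<bullet> u \<le> width V u"
    by auto
  then show ?thesis by (simp add: inner_diff_left abs_if)
qed

lemma integral_triangle_width:
  "((\<lambda>\<theta>. (\<bar>(A - B) \<bullet> dir \<theta>\<bar> + \<bar>(B - C) \<bullet> dir \<theta>\<bar> + \<bar>(C - A) \<bullet> dir \<theta>\<bar>) / 2) has_integral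
    dist A B + dist B C + dist C A) {s .. s + pi}"
proof -
  have "((\<lambda>\<theta>. (\<bar>(A - B) \<bullet> dir \<theta>\<bar> + \<bar>(B - C) \<bullet> dir \<theta>\<bar> + \<bar>(C - A) \<bullet> dir \<theta>\<bar>) / 2) has_integral
    (2 * norm (A - B) + 2 * norm (B - C) + 2 * norm (C - A)) / 2) {s .. s + pi}"
    by (intro has_integral_divide has_integral_add integral_abs_inner_dir)
  then show ?thesis by (simp add: dist_norm add_divide_distrib)
qed

lemma perimeter_ge_triangle:
  assumes V: "finite V" and ne: "interior (convex hull V) \<noteq> {}"
    and sub: "{A, B, C} \<subseteq> convex hull V"
  shows "dist A B + dist B C + dist C A \<le> perimeter (convex hull V)"
proof -
  have V0: "V \<noteq> {}" using ne by auto
  have "dist A B + dist B C + dist C A \<le> integral {0 .. 0 + pi} (\<lambda>\<theta>. width V (dir \<theta>))"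
    using integral_triangle_width
  proof (rule has_integral_le)
    show "((\<lambda>\<theta>. width V (dir \<theta>)) has_integral
        integral {0 .. 0 + pi} (\<lambda>\<theta>. width V (dir \<theta>))) {0 .. 0 + pi}"
      by (intro integrable_integral integrable_continuous_real continuous_on_width V V0)
  qed (use width_ge_triangle[OF V sub] in auto)
  also have "\<dots> \<le> perimeter (convex hull V)" by (rule perimeter_ge_integral_width[OF V ne])
  finally show ?thesis .
qed

text \<open>Separating \<open>X\<close> from the triangle gives a direction in which the polygon is strictly wider than the
triangle. By continuity of both widths this makes the integral strictly larger.\<close>

lemma perimeter_gt_triangle:
  assumes V: "finite V" and ne: "interior (convex hull V) \<noteq> {}"
    and sub: "{A, B, C} \<subseteq> convex hull V"
    and X: "X \<in> convex hull V" "X \<notin> convex hull {A, B, C}"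
  shows "dist A B + dist B C + dist C A < perimeter (convex hull V)"
proof -
  have V0: "V \<noteq> {}" using ne by auto
  define f where
    "f \<theta> = (\<bar>(A - B) \<bullet> dir \<theta>\<bar> + \<bar>(B - C) \<bullet> dir \<theta>\<bar> + \<bar>(C - A) \<bullet> dir \<theta>\<bar>) / 2" for \<theta>
  have "closed (convex hull {A, B, C})"
    by (intro compact_imp_closed finite_imp_compact_convex_hull) auto
  then obtain a c where ac: "a \<bullet> X < c" "\<And>p. p \<in> convex hull {A, B, C} \<Longrightarrow> a \<bullet> p > c"
    using separating_hyperplane_closed_point[of "convex hull {A, B, C}" X] X by auto
  have "A \<in> convex hull {A, B, C}" by (simp add: hull_inc)
  with ac have "a \<noteq> 0" by force
  then have "norm ((- 1 / norm a) *\<^sub>R a) = 1" by simp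
  then obtain \<theta>\<^sub>0 where th: "(- 1 / norm a) *\<^sub>R a = dir \<theta>\<^sub>0" using unit_vector_is_dir by metis
  have ahead: "p \<bullet> dir \<theta>\<^sub>0 < X \<bullet> dir \<theta>\<^sub>0" if "p \<in> {A, B, C}" for p
  proof -
    have "a \<bullet> X < a \<bullet> p" using ac(1) ac(2)[of p] that by (force intro: hull_inc)
    then show ?thesis using \<open>a \<noteq> 0\<close> by (simp flip: th add: divide_simps inner_commute[of a])
  qed
  have "(X - p) \<bullet> dir \<theta>\<^sub>0 \<le> width V (dir \<theta>\<^sub>0)" if "p \<in> {A, B, C}" for p
    using width_ge V X(1) sub that by blast
  then have lt: "f \<theta>\<^sub>0 < width V (dir \<theta>\<^sub>0)"
    using ahead[of A] ahead[of B] ahead[of C] unfolding f_def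
    by (simp add: inner_diff_left abs_if) (smt (verit) field_sum_of_halves)
  \<comment> \<open>Starting the half turn at \<open>\<theta>\<^sub>0\<close> puts the strict inequality inside the domain of integration.\<close>
  let ?I = "{\<theta>\<^sub>0 .. \<theta>\<^sub>0 + pi}"
  have cont: "continuous_on ?I (\<lambda>\<theta>. width V (dir \<theta>) - f \<theta>)"
    unfolding f_def by (intro continuous_intros continuous_on_width V V0) simp
  have "integral ?I (\<lambda>\<theta>. width V (dir \<theta>) - f \<theta>) \<noteq> 0"
    using integral_eq_0_iff[OF cont] lt width_ge_triangle[OF V sub]
    by (force simp: f_def)
  moreover have "integral ?I (\<lambda>\<theta>. width V (dir \<theta>) - f \<theta>) \<ge> 0"
    using width_ge_triangle[OF V sub]
    by (intro integral_nonneg integrable_continuous_real cont) (simp add: f_def)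
  moreover have "integral ?I (\<lambda>\<theta>. width V (dir \<theta>) - f \<theta>)
    = integral ?I (\<lambda>\<theta>. width V (dir \<theta>)) - integral ?I f"
    by (intro Henstock_Kurzweil_Integration.integral_diff integrable_continuous_real
        continuous_on_width V V0) (auto simp: f_def intro!: continuous_intros)
  moreover have "integral ?I f = dist A B + dist B C + dist C A"
    using integral_triangle_width[of A B C "\<theta>\<^sub>0"] unfolding f_def by (rule integral_unique)
  ultimately show ?thesis using perimeter_ge_integral_width[OF V ne, of "\<theta>\<^sub>0"] by linarith
qed

section \<open>Local minima of the width\<close>

text \<open>The points where \<open>u\<close> is maximal form a proper face, of dimension at most 1. With two points in it
it is a side.\<close>

lemma supporting_edge:
  fixes P :: "plane set"
  assumes "polytope P" "interior P \<noteq> {}" "u \<noteq> 0"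
    and x: "x \<in> P" "\<And>p. p \<in> P \<Longrightarrow> u \<bullet> p \<le> u \<bullet> x"
    and q: "q \<in> P" "q \<noteq> x" "u \<bullet> q = u \<bullet> x"
  obtains A B where "closed_segment A B edge_of P" "(A - B) \<bullet> u = 0"
proof -
  define F where "F = P \<inter> {p. u \<bullet> p = u \<bullet> x}"
  have face: "F face_of P"
    unfolding F_def using x(2) polytope_imp_convex[OF assms(1)]
    by (rule face_of_Int_supporting_hyperplane_le[rotated])
  have "F \<noteq> P"
  proof
    assume "F = P"
    then have "interior P \<subseteq> interior {p. u \<bullet> p = u \<bullet> x}"
      by (intro interior_mono) (auto simp: F_def)
    then show False using assms(2,3) by (simp add: interior_hyperplane)
  qed
  then have "aff_dim F < aff_dim P"
    using face face_of_aff_dim_lt polytope_imp_convex[OF assms(1)] by blast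
  also have "aff_dim P = 2" using aff_dim_nonempty_interior[OF assms(2)] by simp
  finally have "aff_dim F \<le> 1" by simp
  moreover have "{x, q} \<subseteq> F" using x q by (auto simp: F_def)
  then have "aff_dim {x, q} \<le> aff_dim F" by (rule aff_dim_subset)
  then have "aff_dim F \<ge> 1" using q(2) by (simp add: aff_dim_2)
  ultimately have edge: "F edge_of P" using face by (simp add: edge_of_def)
  then obtain A B where AB: "F = closed_segment A B" using edge_is_segment[OF assms(1)] by metis
  then have "A \<in> F" "B \<in> F" by auto
  then have "(A - B) \<bullet> u = 0" by (simp add: F_def inner_diff_left inner_commute[of u])
  then show thesis using that edge AB by blast
qed

text \<open>If neither supporting line orthogonal to \<open>dir \<theta>\<close> contained a side, each would touch the polygon in a
single vertex, \<open>x\<close> and \<open>y\<close>, and the same two vertices would determine the width in all nearby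
directions. There the width would be \<open>(x - y) \<bullet> dir t\<close>, a positive multiple of a cosine near \<open>\<theta>\<close>, which is
strictly concave and has no local minimum.\<close>

lemma local_min_of_width_is_edge_normal:
  fixes V :: "plane set"
  assumes V: "finite V" and ne: "interior (convex hull V) \<noteq> {}"
    and lr: "l < \<theta>" "\<theta> < r"
    and min: "\<And>t. l \<le> t \<Longrightarrow> t \<le> r \<Longrightarrow> width V (dir \<theta>) \<le> width V (dir t)"
  obtains A B where "closed_segment A B edge_of (convex hull V)" "(A - B) \<bullet> dir \<theta> = 0"
proof (rule ccontr)
  note sides = that
  assume no_side: "\<not> thesis"
  let ?P = "convex hull V" and ?u = "dir \<theta>"
  have poly: "polytope ?P" using V by (auto simp: polytope_def)
  have V0: "V \<noteq> {}" using ne by auto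
  have u0: "?u \<noteq> 0" using norm_dir[of \<theta>] by force
  obtain x y where xy: "x \<in> V" "y \<in> V" "width V ?u = (x - y) \<bullet> ?u"
    using width_attained[OF V V0] by metis
  have xyP: "x \<in> ?P" "y \<in> ?P" using xy by (auto intro: hull_inc)
  have top: "?u \<bullet> p \<le> ?u \<bullet> x" if "p \<in> ?P" for p
    using width_ge[OF V that xyP(2), of ?u] xy(3)
    by (simp add: inner_diff_left inner_commute[of ?u])
  have bot: "?u \<bullet> y \<le> ?u \<bullet> p" if "p \<in> ?P" for p
    using width_ge[OF V xyP(1) that, of ?u] xy(3)
    by (simp add: inner_diff_left inner_commute[of ?u])
  have pos: "0 < width V ?u"
  proof (rule ccontr)
    assume "\<not> ?thesis"
    then have "?u \<bullet> x \<le> ?u \<bullet> y" using xy(3) by (simp add: inner_diff_left inner_commute[of ?u])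
    then have "?P \<subseteq> {p. ?u \<bullet> p = ?u \<bullet> x}" using top bot by (intro subsetI CollectI antisym) (auto intro: order_trans)
    then have "interior ?P \<subseteq> interior {p. ?u \<bullet> p = ?u \<bullet> x}" by (rule interior_mono)
    then show False using ne u0 by (simp add: interior_hyperplane)
  qed
  have top_unique: "?u \<bullet> p < ?u \<bullet> x" if p: "p \<in> V" "p \<noteq> x" for p
  proof (rule ccontr)
    have pP: "p \<in> ?P" using p by (simp add: hull_inc)
    assume "\<not> ?thesis"
    then have "?u \<bullet> p = ?u \<bullet> x" using top[OF pP] by linarith
    then obtain A B where "closed_segment A B edge_of ?P" "(A - B) \<bullet> ?u = 0"
      using supporting_edge[OF poly ne u0 xyP(1) top pP p(2)] by blast
    then show False using sides no_side by blast
  qed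
  have bot_unique: "?u \<bullet> y < ?u \<bullet> p" if p: "p \<in> V" "p \<noteq> y" for p
  proof (rule ccontr)
    have pP: "p \<in> ?P" using p by (simp add: hull_inc)
    assume "\<not> ?thesis"
    then have "(- ?u) \<bullet> p = (- ?u) \<bullet> y" using bot[OF pP] by simp
    moreover have "- ?u \<noteq> 0" "\<And>p. p \<in> ?P \<Longrightarrow> (- ?u) \<bullet> p \<le> (- ?u) \<bullet> y" using u0 bot by auto
    ultimately obtain A B where "closed_segment A B edge_of ?P" "(A - B) \<bullet> (- ?u) = 0"
      using supporting_edge[OF poly ne _ xyP(2) _ pP p(2)] by blast
    then show False using sides[of A B] no_side by simp
  qed
  have "eventually (\<lambda>t. \<forall>p\<in>V \<times> V. (fst p - snd p) \<bullet> dir t \<le> (x - y) \<bullet> dir t) (at \<theta>)"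
  proof (intro eventually_ball_finite ballI finite_cartesian_product V)
    fix p assume p: "p \<in> V \<times> V"
    show "eventually (\<lambda>t. (fst p - snd p) \<bullet> dir t \<le> (x - y) \<bullet> dir t) (at \<theta>)"
    proof (cases "p = (x, y)")
      case False
      then have "(fst p - snd p) \<bullet> ?u < (x - y) \<bullet> ?u"
        using p top_unique[of "fst p"] bot_unique[of "snd p"]
        by (cases "fst p = x"; cases "snd p = y")
           (auto simp: inner_diff_left inner_commute[of ?u])
      then have "0 < (x - y - (fst p - snd p)) \<bullet> ?u" by (simp add: inner_diff_left)
      moreover have "((\<lambda>t. (x - y - (fst p - snd p)) \<bullet> dir t)
          \<longlongrightarrow> (x - y - (fst p - snd p)) \<bullet> ?u) (at \<theta>)"
        using continuous_on_inner_dir[of UNIV "x - y - (fst p - snd p)"]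
        by (simp add: continuous_on_eq_continuous_at isCont_def)
      ultimately have "eventually (\<lambda>t. 0 < (x - y - (fst p - snd p)) \<bullet> dir t) (at \<theta>)"
        by (rule order_tendstoD(1)[rotated])
      then show ?thesis by (rule eventually_mono) (simp add: inner_diff_left)
    qed simp
  qed
  then obtain d where d: "d > 0"
    "\<And>t p q. \<lbrakk>t \<noteq> \<theta>; dist t \<theta> < d; p \<in> V; q \<in> V\<rbrakk> \<Longrightarrow> (p - q) \<bullet> dir t \<le> (x - y) \<bullet> dir t"
    unfolding eventually_at by (simp add: Ball_def) blast
  have near: "width V (dir t) \<le> (x - y) \<bullet> dir t" if "t \<noteq> \<theta>" "dist t \<theta> < d" for t
    by (rule width_attained[OF V V0, of "dir t"]) (simp add: d(2)[OF that])
  define h where "h = Min {d / 2, \<theta> - l, r - \<theta>, 1}"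
  have h: "0 < h" "h < d" "h \<le> \<theta> - l" "h \<le> r - \<theta>" "h \<le> 1"
    using d(1) lr by (auto simp: h_def)
  \<comment> \<open>Strict concavity as a second difference: the values at \<open>\<theta> + h\<close> and \<open>\<theta> - h\<close> average to
    the value at \<open>\<theta>\<close> times \<open>cos h\<close>.\<close>
  have "2 * width V ?u \<le> width V (dir (\<theta> + h)) + width V (dir (\<theta> - h))"
    using min[of "\<theta> + h"] min[of "\<theta> - h"] h by simp
  also have "\<dots> \<le> (x - y) \<bullet> dir (\<theta> + h) + (x - y) \<bullet> dir (\<theta> - h)"
    using near[of "\<theta> + h"] near[of "\<theta> - h"] h by (simp add: dist_real_def)
  also have "\<dots> = 2 * (width V ?u * cos h)"
    unfolding xy(3) inner_dir by (simp add: cos_add cos_diff sin_add sin_diff algebra_simps)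
  finally have "width V ?u * 1 \<le> width V ?u * cos h" by simp
  then have "1 \<le> cos h" using pos by simp
  moreover have "cos h < cos 0" using h pi_ge_two by (intro cos_monotone_0_pi) auto
  ultimately show False by simp
qed

section \<open>Polygons with all sides shorter than one\<close>

lemma dir_decomposition:
  "x = (x \<bullet> dir \<theta>) *\<^sub>R dir \<theta> + (x \<bullet> dir (\<theta> + pi / 2)) *\<^sub>R dir (\<theta> + pi / 2)"
proof -
  have "x $ 1 = (x $ 1 * cos \<theta> + x $ 2 * sin \<theta>) * cos \<theta> - (x $ 2 * cos \<theta> - x $ 1 * sin \<theta>) * sin \<theta>"
    "x $ 2 = (x $ 1 * cos \<theta> + x $ 2 * sin \<theta>) * sin \<theta> + (x $ 2 * cos \<theta> - x $ 1 * sin \<theta>) * cos \<theta>"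
    using sin_cos_squared_add[of \<theta>] by algebra+
  then show ?thesis
    by (simp add: vec_eq_iff forall_2 inner_dir) (simp add: dir_def cos_add sin_add)
qed

text \<open>\<open>A\<close>, \<open>B\<close>, \<open>C\<close> form an isosceles triangle with legs 1 and height in direction \<open>\<plusminus>dir \<theta>\<close>, so its legs
deviate from \<open>\<theta>\<close> by half the apex angle \<open>\<alpha>\<close>, where \<open>sin \<alpha>\<close> is half the base. A base shorter than 1 means
\<open>\<alpha> < pi / 6\<close>. The reversed legs appear because \<open>C\<close> may lie on either side of \<open>AB\<close>.\<close>

lemma apex_directions:
  assumes orth: "(A - B) \<bullet> dir \<theta> = 0" and "A \<noteq> B" "dist A B < 1" "dist A C = 1" "dist B C = 1"
  obtains \<alpha> where "0 \<le> \<alpha>" "\<alpha> < pi / 6"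
    "{dir (\<theta> + \<alpha>), dir (\<theta> - \<alpha>)} \<subseteq> {C - A, C - B, A - C, B - C}"
proof -
  let ?n = "dir \<theta>" and ?t = "dir (\<theta> + pi / 2)"
  define a where "a = (C - A) \<bullet> ?n"
  define b where "b = (C - A) \<bullet> ?t"
  define b' where "b' = (C - B) \<bullet> ?t"
  have a': "a = (C - B) \<bullet> ?n" using orth by (simp add: a_def inner_diff_left)
  have CA: "C - A = a *\<^sub>R ?n + b *\<^sub>R ?t" unfolding a_def b_def by (rule dir_decomposition)
  have CB: "C - B = a *\<^sub>R ?n + b' *\<^sub>R ?t" unfolding a' b'_def by (rule dir_decomposition)
  have nt: "?n \<bullet> ?t = 0" by (simp add: inner_dir_dir cos_diff cos_add sin_add)
  have nrm: "(norm (p *\<^sub>R ?n + q *\<^sub>R ?t))\<^sup>2 = p\<^sup>2 + q\<^sup>2" for p q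
    by (simp add: norm_add_Pythagorean orthogonal_def nt)
  have 1: "a\<^sup>2 + b\<^sup>2 = 1" "a\<^sup>2 + b'\<^sup>2 = 1"
    using nrm[of a b] nrm[of a b'] assms(4,5)
    by (simp_all add: dist_norm norm_minus_commute[of _ C] flip: CA CB)
  have "b \<noteq> b'" using CA CB \<open>A \<noteq> B\<close> by (metis diff_left_imp_eq)
  then have b': "b' = - b" using 1 by (metis add_left_cancel power2_eq_iff)
  have "A - B = 0 *\<^sub>R ?n + (- 2 * b) *\<^sub>R ?t" using CA CB b'
    by (simp add: vec_eq_iff forall_2 algebra_simps)
  then have "(dist A B)\<^sup>2 = (2 * b)\<^sup>2" using nrm[of 0 "- 2 * b"] by (simp add: dist_norm)
  then have "dist A B = \<bar>2 * b\<bar>" by (metis abs_of_nonneg real_sqrt_abs zero_le_dist)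
  then have b: "\<bar>b\<bar> < 1 / 2" using assms(3) by simp
  define \<alpha> where "\<alpha> = arcsin \<bar>b\<bar>"
  have "0 \<le> \<alpha>" using b by (simp add: \<alpha>_def arcsin_nonneg)
  moreover have "\<alpha> < pi / 6"
  proof -
    have "arcsin (1 / 2) = pi / 6" using arcsin_sin[of "pi / 6"] by (simp add: sin_30)
    moreover have "arcsin \<bar>b\<bar> < arcsin (1 / 2)" using b by (intro arcsin_less_arcsin) auto
    ultimately show ?thesis by (simp add: \<alpha>_def)
  qed
  moreover have "sin \<alpha> = \<bar>b\<bar>" using b by (simp add: \<alpha>_def)
  moreover have "cos \<alpha> = \<bar>a\<bar>"
  proof -
    have "cos \<alpha> = sqrt (1 - b\<^sup>2)" using b by (simp add: \<alpha>_def cos_arcsin)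
    also have "1 - b\<^sup>2 = a\<^sup>2" using 1 by simp
    finally show ?thesis by simp
  qed
  ultimately have
    plus: "dir (\<theta> + \<alpha>) = \<bar>a\<bar> *\<^sub>R ?n + \<bar>b\<bar> *\<^sub>R ?t" and
    minus: "dir (\<theta> - \<alpha>) = \<bar>a\<bar> *\<^sub>R ?n + (- \<bar>b\<bar>) *\<^sub>R ?t" 
    by (simp_all add: dir_def vec_eq_iff forall_2 cos_add sin_add cos_diff sin_diff mult.commute)
  have AC: "A - C = (- a) *\<^sub>R ?n + (- b) *\<^sub>R ?t" using CA by (simp add: algebra_simps)
  have BC: "B - C = (- a) *\<^sub>R ?n + b *\<^sub>R ?t" using CB b' by (simp add: algebra_simps)
  have "{dir (\<theta> + \<alpha>), dir (\<theta> - \<alpha>)} \<subseteq> {C - A, C - B, A - C, B - C}"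
    unfolding plus minus CA CB AC BC b' by (cases "a \<ge> 0"; cases "b \<ge> 0") auto
  then show thesis using that \<open>0 \<le> \<alpha>\<close> \<open>\<alpha> < pi / 6\<close> by blast
qed

text \<open>The right-hand side is the chord of the sine from 0 to \<open>pi / 6\<close>; strict concavity of the sine puts
the graph above it.\<close>

lemma sin_gt_chord:
  assumes "0 < x" "x < pi / 6"
  shows "sin x > 3 / pi * x"
proof -
  obtain c where c: "0 < c" "c < x" "sin x - sin 0 = (x - 0) * cos c"
    using MVT2[of 0 x sin cos] assms by (auto intro!: derivative_eq_intros)
  obtain d where d: "x < d" "d < pi / 6" "sin (pi / 6) - sin x = (pi / 6 - x) * cos d"
    using MVT2[of x "pi / 6" sin cos] assms by (auto intro!: derivative_eq_intros)
  have "cos d < cos c" using c d assms by (intro cos_monotone_0_pi) auto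
  then have "x * ((pi / 6 - x) * cos d) < (pi / 6 - x) * (x * cos c)"
    using assms by simp
  then have "x * (1 / 2 - sin x) < (pi / 6 - x) * sin x" using c(3) d(3) by (simp add: sin_30)
  then show ?thesis by (simp add: field_simps)
qed

text \<open>In the application \<open>U\<close> is the set of unit vectors along the legs provided by the \<open>\<Delta>\<close> property, and \<open>l\<close>, \<open>r\<close> are
consecutive directions in it. Each of these vectors is a difference of points of the polygon, so in
direction \<open>\<theta>\<close> the width is at least \<open>cos (\<theta> - l)\<close> and \<open>cos (r - \<theta>)\<close>. On a gap shorter than \<open>pi / 3\<close>
this gives the integral \<open>2 sin ((r - l) / 2)\<close>, and \<open>sin_gt_chord\<close> applies.

On a gap of at least \<open>pi / 3\<close> the width never drops below 1. It is at least 1 at both ends, so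
otherwise it would have an interior minimum, at the normal of a side. The legs belonging to that side
lie within less than \<open>pi / 6\<close> of the normal, on both sides of it and outside the gap, so the gap would
be shorter than \<open>pi / 3\<close>.\<close>

lemma integral_width_gap:
  fixes V :: "plane set"
  assumes V: "finite V" and ne: "interior (convex hull V) \<noteq> {}"
    and U: "\<And>w. w \<in> U \<Longrightarrow> \<exists>x\<in>convex hull V. \<exists>y\<in>convex hull V. w = x - y"
    and normals: "\<And>A B \<theta>. \<lbrakk>closed_segment A B edge_of (convex hull V); (A - B) \<bullet> dir \<theta> = 0\<rbrakk>
      \<Longrightarrow> \<exists>\<alpha>. 0 \<le> \<alpha> \<and> \<alpha> < pi / 6 \<and> dir (\<theta> + \<alpha>) \<in> U \<and> dir (\<theta> - \<alpha>) \<in> U"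
    and lr: "l < r" "dir l \<in> U" "dir r \<in> U"
    and gap: "\<And>t. \<lbrakk>l < t; t < r\<rbrakk> \<Longrightarrow> dir t \<notin> U"
  shows "3 / pi * (r - l) < integral {l..r} (\<lambda>\<theta>. width V (dir \<theta>))"
proof -
  let ?w = "\<lambda>\<theta>. width V (dir \<theta>)"
  have V0: "V \<noteq> {}" using ne by auto
  have cont: "continuous_on S ?w" for S by (rule continuous_on_width[OF V V0])
  have int: "?w integrable_on {a..b}" for a b by (rule integrable_continuous_real[OF cont])
  have ge: "cos (t - \<theta>) \<le> ?w \<theta>" if t: "dir t \<in> U" for t \<theta>
  proof -
    obtain x y where "x \<in> convex hull V" "y \<in> convex hull V" "dir t = x - y" using U[OF t] by blast
    then show ?thesis using width_ge[OF V, of x y "dir \<theta>"] by (metis inner_dir_dir)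
  qed
  show ?thesis
  proof (cases "r - l < pi / 3")
    case True
    define m where "m = (l + r) / 2"
    have m: "l \<le> m" "m \<le> r" "m - l = (r - l) / 2" "r - m = (r - l) / 2"
      using lr by (auto simp: m_def field_simps)
    have 1: "((\<lambda>\<theta>. cos (\<theta> - l)) has_integral (sin (m - l) - sin (l - l))) {l..m}"
      by (rule fundamental_theorem_of_calculus[OF m(1)])
         (auto intro!: derivative_eq_intros simp flip: has_real_derivative_iff_has_vector_derivative)
    have 2: "((\<lambda>\<theta>. cos (r - \<theta>)) has_integral (- sin (r - r) - (- sin (r - m)))) {m..r}"
      by (rule fundamental_theorem_of_calculus[OF m(2)])
         (auto intro!: derivative_eq_intros simp flip: has_real_derivative_iff_has_vector_derivative)
    have "sin (m - l) - sin (l - l) \<le> integral {l..m} ?w"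
      using 1 integrable_integral[OF int]
    proof (rule has_integral_le)
      show "cos (\<theta> - l) \<le> ?w \<theta>" for \<theta>
        using ge[OF lr(2), of \<theta>] by (metis cos_minus minus_diff_eq)
    qed
    moreover have "- sin (r - r) - (- sin (r - m)) \<le> integral {m..r} ?w"
      using 2 integrable_integral[OF int] by (rule has_integral_le) (rule ge[OF lr(3)])
    moreover have "integral {l..m} ?w + integral {m..r} ?w = integral {l..r} ?w"
      by (rule Henstock_Kurzweil_Integration.integral_combine[OF m(1,2) int])
    ultimately have "2 * sin ((r - l) / 2) \<le> integral {l..r} ?w" using m by simp
    moreover have "sin ((r - l) / 2) > 3 / pi * ((r - l) / 2)"
      using True lr(1) by (intro sin_gt_chord) auto
    ultimately show ?thesis by simp
  next
    case False
    have w1: "1 \<le> ?w \<theta>" if \<theta>: "\<theta> \<in> {l..r}" for \<theta>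
    proof (rule ccontr)
      assume low: "\<not> 1 \<le> ?w \<theta>"
      obtain \<theta>\<^sub>0 where min: "\<theta>\<^sub>0 \<in> {l..r}" "\<And>t. t \<in> {l..r} \<Longrightarrow> ?w \<theta>\<^sub>0 \<le> ?w t"
        using continuous_attains_inf[OF _ _ cont, of "{l..r}"] lr(1) by auto
      have "?w \<theta>\<^sub>0 < 1" using min(2)[OF \<theta>] low by linarith
      moreover have "1 \<le> ?w l" "1 \<le> ?w r" using ge[OF lr(2), of l] ge[OF lr(3), of r] by auto
      ultimately have "\<theta>\<^sub>0 \<noteq> l" "\<theta>\<^sub>0 \<noteq> r" by auto
      then have lt: "l < \<theta>\<^sub>0" "\<theta>\<^sub>0 < r" using min(1) by auto
      obtain A B where "closed_segment A B edge_of (convex hull V)" "(A - B) \<bullet> dir \<theta>\<^sub>0 = 0"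
        using local_min_of_width_is_edge_normal[OF V ne lt] min(2) by (metis atLeastAtMost_iff)
      then obtain \<alpha> where \<alpha>: "0 \<le> \<alpha>" "\<alpha> < pi / 6" "dir (\<theta>\<^sub>0 + \<alpha>) \<in> U" "dir (\<theta>\<^sub>0 - \<alpha>) \<in> U"
        using normals by blast
      then have "\<theta>\<^sub>0 - \<alpha> \<le> l" "r \<le> \<theta>\<^sub>0 + \<alpha>"
        using gap[of "\<theta>\<^sub>0 - \<alpha>"] gap[of "\<theta>\<^sub>0 + \<alpha>"] lt by force+
      then show False using \<alpha> False by linarith
    qed
    have "((\<lambda>\<theta>. 1) has_integral (r - l)) {l..r}"
      using has_integral_const_real[of "1::real" l r] lr(1) by simp
    then have "r - l \<le> integral {l..r} ?w"
      using integrable_integral[OF int] w1 by (rule has_integral_le)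
    moreover have "3 / pi * (r - l) < 1 * (r - l)"
      using lr(1) pi_gt3 by (intro mult_strict_right_mono) auto
    ultimately show ?thesis by simp
  qed
qed

lemma inj_on_dir:
  assumes "r - l \<le> pi"
  shows "inj_on dir {l..r}"
proof (rule inj_onI, rule ccontr)
  fix a b assume ab: "a \<in> {l..r}" "b \<in> {l..r}" "dir a = dir b" "a \<noteq> b"
  have "cos \<bar>a - b\<bar> < cos 0" using ab assms by (intro cos_monotone_0_pi) auto
  moreover have "cos (a - b) = 1" using inner_dir_dir[of a b] inner_dir_dir[of b b] ab(3) by simp
  ultimately show False by simp
qed

text \<open>The gap estimate is additive in the interval, so it extends to all intervals between directions
in \<open>U\<close> by splitting at intermediate directions.\<close>

lemma integral_width_chain:
  fixes V :: "plane set"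
  assumes V: "finite V" and ne: "interior (convex hull V) \<noteq> {}"
    and U: "\<And>w. w \<in> U \<Longrightarrow> \<exists>x\<in>convex hull V. \<exists>y\<in>convex hull V. w = x - y"
    and normals: "\<And>A B \<theta>. \<lbrakk>closed_segment A B edge_of (convex hull V); (A - B) \<bullet> dir \<theta> = 0\<rbrakk>
      \<Longrightarrow> \<exists>\<alpha>. 0 \<le> \<alpha> \<and> \<alpha> < pi / 6 \<and> dir (\<theta> + \<alpha>) \<in> U \<and> dir (\<theta> - \<alpha>) \<in> U"
    and fin: "finite U"
    and lr: "l < r" "r - l \<le> pi" "dir l \<in> U" "dir r \<in> U"
  shows "3 / pi * (r - l) < integral {l..r} (\<lambda>\<theta>. width V (dir \<theta>))"
  using lr
proof (induction "card {t. l < t \<and> t < r \<and> dir t \<in> U}" arbitrary: l r rule: less_induct)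
  case less
  let ?T = "\<lambda>l r. {t. l < t \<and> t < r \<and> dir t \<in> U}"
  show ?case
  proof (cases "?T l r = {}")
    case True
    \<comment> \<open>No direction of \<open>U\<close> lies strictly in between, so \<open>l\<close> and \<open>r\<close> bound a gap.\<close>
    show ?thesis
      by (rule integral_width_gap[OF V ne, where U = U]) (use less.prems True U normals in blast)+
  next
    case False
    then obtain m where m: "l < m" "m < r" "dir m \<in> U" by blast
    have "finite (dir -` U \<inter> {l..r})"
      by (rule finite_vimage_IntI[OF fin inj_on_dir[OF less.prems(2)]])
    then have T: "finite (?T l r)" by (rule finite_subset[rotated]) auto
    have "?T l m \<subset> ?T l r" "?T m r \<subset> ?T l r" using m by auto
    then have "card (?T l m) < card (?T l r)" "card (?T m r) < card (?T l r)"
      using T by (auto intro: psubset_card_mono)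
    then have "3 / pi * (m - l) < integral {l..m} (\<lambda>\<theta>. width V (dir \<theta>))"
      "3 / pi * (r - m) < integral {m..r} (\<lambda>\<theta>. width V (dir \<theta>))"
      using less m by auto
    moreover have "integral {l..m} (\<lambda>\<theta>. width V (dir \<theta>)) + integral {m..r} (\<lambda>\<theta>. width V (dir \<theta>))
        = integral {l..r} (\<lambda>\<theta>. width V (dir \<theta>))"
      using m V ne by (intro Henstock_Kurzweil_Integration.integral_combine
          integrable_continuous_real continuous_on_width) auto
    ultimately show ?thesis by (simp add: right_diff_distrib)
  qed
qed

text \<open>The legs of all sides, taken with both orientations, form the finite set \<open>U\<close>. If \<open>dir s\<close> is in \<open>U\<close>, so
is its negative \<open>dir (s + pi)\<close>, and the chain estimate over this half turn gives the bound 3.\<close>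

lemma perimeter_gt_3_if_sides_short:
  fixes V :: "plane set"
  assumes V: "finite V" and ne: "interior (convex hull V) \<noteq> {}"
    and Delta: "Delta_property (convex hull V)"
    and short: "\<And>A B. closed_segment A B edge_of (convex hull V) \<Longrightarrow> dist A B < 1"
  shows "3 < perimeter (convex hull V)"
proof -
  let ?P = "convex hull V"
  have poly: "polytope ?P" using V by (auto simp: polytope_def)
  have "\<forall>A B. \<exists>C. closed_segment A B edge_of ?P \<longrightarrow> C \<in> ?P \<and> dist A C = 1 \<and> dist B C = 1"
    using Delta unfolding Delta_property_def side_endpoints_def by blast
  then obtain c where c: "\<And>A B. closed_segment A B edge_of ?P \<Longrightarrow>
      c A B \<in> ?P \<and> dist A (c A B) = 1 \<and> dist B (c A B) = 1" by metis
  define S where "S = {(A, B). closed_segment A B edge_of ?P}"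
  define U where "U = (\<Union>(A, B)\<in>S. {c A B - A, c A B - B, A - c A B, B - c A B})"
  have "S \<subseteq> vertices ?P \<times> vertices ?P"
    using segment_face_of[of _ _ ?P] by (auto simp: S_def edge_of_def vertices_def face_of_singleton)
  moreover have "finite (vertices ?P)"
    unfolding vertices_def
    by (intro finite_polyhedron_extreme_points polytope_imp_polyhedron poly)
  ultimately have "finite S" by (auto intro: finite_subset)
  then have fin: "finite U" by (auto simp: U_def)
  have U: "\<exists>x\<in>?P. \<exists>y\<in>?P. w = x - y" if w: "w \<in> U" for w
  proof -
    obtain A B where AB: "closed_segment A B edge_of ?P"
        "w \<in> {c A B - A, c A B - B, A - c A B, B - c A B}"
      using w by (auto simp: U_def S_def)
    moreover have "A \<in> ?P" "B \<in> ?P" using edge_of_imp_subset[OF AB(1)] by auto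
    moreover have "c A B \<in> ?P" using c[OF AB(1)] by blast
    ultimately show ?thesis by blast
  qed
  have normals: "\<exists>\<alpha>. 0 \<le> \<alpha> \<and> \<alpha> < pi / 6 \<and> dir (\<theta> + \<alpha>) \<in> U \<and> dir (\<theta> - \<alpha>) \<in> U"
    if AB: "closed_segment A B edge_of ?P" "(A - B) \<bullet> dir \<theta> = 0" for A B \<theta>
  proof -
    have "A \<noteq> B" using AB(1) by (auto simp: edge_of_def)
    then obtain \<alpha> where \<alpha>: "0 \<le> \<alpha>" "\<alpha> < pi / 6"
      "{dir (\<theta> + \<alpha>), dir (\<theta> - \<alpha>)} \<subseteq> {c A B - A, c A B - B, A - c A B, B - c A B}"
      using apex_directions[OF AB(2) _ short[OF AB(1)]] c[OF AB(1)] by blast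
    have "{c A B - A, c A B - B, A - c A B, B - c A B} \<subseteq> U"
      using AB(1) by (auto simp: U_def S_def)
    then show ?thesis using \<alpha> by blast
  qed
  obtain z where "z \<in> interior ?P" using ne by blast
  then obtain e where e: "e edge_of ?P"
    using line_meets_two_edges[OF poly, of z "dir 0"] norm_dir[of 0]
    by (metis norm_zero zero_neq_one)
  then obtain A B where AB: "closed_segment A B edge_of ?P" using edge_is_segment[OF poly] by metis
  then have "norm (c A B - A) = 1" using c by (metis dist_norm norm_minus_commute)
  then obtain s where s: "c A B - A = dir s" using unit_vector_is_dir by metis
  have "dir s \<in> U" "dir (s + pi) \<in> U"
    unfolding dir_plus_pi s[symmetric] using AB by (auto simp: U_def S_def)
  then have "3 / pi * (s + pi - s) < integral {s..s + pi} (\<lambda>\<theta>. width V (dir \<theta>))"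
    by (intro integral_width_chain[OF V ne U normals fin]) auto
  also have "\<dots> \<le> perimeter ?P" by (rule perimeter_ge_integral_width[OF V ne])
  finally show ?thesis by simp
qed

text \<open>Otherwise the polygon would be a segment, which has at most two extreme points.\<close>

lemma interior_nonempty_if_three_vertices:
  fixes P :: "plane set"
  assumes "polytope P" "card (vertices P) \<ge> 3"
  shows "interior P \<noteq> {}"
proof
  assume "interior P = {}"
  have "P \<noteq> {}" using assms(2) by (auto simp: vertices_def extreme_point_of_def)
  have "rel_interior P \<noteq> {}"
    using \<open>P \<noteq> {}\<close> polytope_imp_convex[OF assms(1)] rel_interior_eq_empty by blast
  then have "aff_dim P \<noteq> 2" using \<open>interior P = {}\<close> interior_rel_interior_gen[of P] by auto
  moreover have "aff_dim P \<le> 2" using aff_dim_le_DIM[of P] by simp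
  ultimately have "collinear P" by (simp add: collinear_aff_dim)
  then obtain a b where "P = closed_segment a b"
    using compact_convex_collinear_segment[OF \<open>P \<noteq> {}\<close>] polytope_imp_compact polytope_imp_convex assms(1)
    by metis
  then have "vertices P \<subseteq> {a, b}" by (auto simp: vertices_def extreme_point_of_segment)
  then have "card (vertices P) \<le> card {a, b}" by (intro card_mono) auto
  also have "\<dots> \<le> 2" by (simp add: card_insert_if)
  finally show False using assms(2) by simp
qed

text \<open>A side of length at least 1 spans with its apex a triangle of perimeter at least \<open>2 + 1\<close> inside the
polygon, and a polygon with more points than this triangle has larger perimeter. If there is no such
side, the perimeter exceeds 3 by \<open>perimeter_gt_3_if_sides_short\<close>.\<close>

lemma Delta_perimeter:
  assumes poly: "convex_polygon P" and card: "card (vertices P) \<ge> 3" and Delta: "Delta_property P"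
  shows "perimeter P \<ge> 3" and "perimeter P = 3 \<Longrightarrow> unit_regular_triangle P"
proof -
  obtain V where V: "finite V" and P: "P = convex hull V" using poly by (auto simp: polytope_def)
  have ne: "interior (convex hull V) \<noteq> {}"
    using interior_nonempty_if_three_vertices[OF poly card] P by simp
  have "perimeter P \<ge> 3 \<and> (perimeter P = 3 \<longrightarrow> unit_regular_triangle P)"
  proof (cases "\<forall>A B. closed_segment A B edge_of P \<longrightarrow> dist A B < 1")
    case True
    then show ?thesis using perimeter_gt_3_if_sides_short[OF V ne] Delta P by auto
  next
    case False
    then obtain A B where AB: "closed_segment A B edge_of P" "dist A B \<ge> 1" by force
    then obtain C where C: "C \<in> P" "dist A C = 1" "dist B C = 1"
      using Delta by (auto simp: Delta_property_def side_endpoints_def)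
    have sub: "{A, B, C} \<subseteq> convex hull V" using edge_of_imp_subset[OF AB(1)] C(1) P by auto
    have *: "dist A B + dist B C + dist C A \<le> perimeter P"
      using perimeter_ge_triangle[OF V ne sub] P by simp
    have "unit_regular_triangle P" if three: "perimeter P = 3"
    proof -
      have "P \<subseteq> convex hull {A, B, C}"
        using perimeter_gt_triangle[OF V ne sub] three C AB(2) unfolding P
        by (fastforce simp: dist_commute)
      moreover have "convex hull {A, B, C} \<subseteq> P" using sub P by (simp add: hull_minimal)
      moreover have "dist A B = 1" using * three AB(2) C by (simp add: dist_commute)
      ultimately show ?thesis
        unfolding unit_regular_triangle_def using C by (metis dist_commute subset_antisym)
    qed
    then show ?thesis using * AB(2) C by (simp add: dist_commute)
  qed
  then show "perimeter P \<ge> 3" "perimeter P = 3 \<Longrightarrow> unit_regular_triangle P" by auto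
qed

section \<open>Upper bounds on the perimeter\<close>

text \<open>The value \<open>side x\<close> is the cross product that tells on which side of the line \<open>AB\<close> the point \<open>x\<close> lies.
The line through a side of the polygon supports it, so no two points of the polygon are separated
by this line.\<close>

lemma edge_on_one_side:
  fixes P :: "plane set"
  assumes poly: "polytope P" and ne: "interior P \<noteq> {}"
    and edge: "closed_segment A B edge_of P" and pq: "p \<in> P" "q \<in> P"
  defines "side x \<equiv> (B - A) $ 1 * (x - A) $ 2 - (B - A) $ 2 * (x - A) $ 1"
  shows "0 \<le> side p * side q"
proof -
  let ?e = "closed_segment A B"
  have "A \<noteq> B" using edge by (auto simp: edge_of_def)
  have "aff_dim P = 2" using aff_dim_nonempty_interior[OF ne] by simp
  then have "?e \<noteq> P" using edge by (auto simp: edge_of_def)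
  moreover have "?e exposed_face_of P"
    using edge by (simp add: exposed_face_of_polyhedron[OF polytope_imp_polyhedron[OF poly]] edge_of_def)
  ultimately obtain a b where a: "a \<noteq> 0" "P \<subseteq> {x. a \<bullet> x \<le> b}" "?e = P \<inter> {x. a \<bullet> x = b}"
    unfolding exposed_face_of by auto
  have "A \<in> ?e" "B \<in> ?e" by auto
  then have AB: "a \<bullet> A = b" "a \<bullet> B = b" unfolding a(3) by auto
  define d where "d = B - A"
  \<comment> \<open>The normal \<open>a\<close> of the supporting line is \<open>t\<close> times the vector \<open>d\<close> turned by a right angle.\<close>
  define t where "t = (a $ 2 * d $ 1 - a $ 1 * d $ 2) / (d \<bullet> d)"
  have dd: "d \<bullet> d \<noteq> 0" using \<open>A \<noteq> B\<close> by (simp add: d_def)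
  have "a \<bullet> d = 0" using AB by (simp add: d_def inner_diff_right)
  then have orth: "a $ 1 * d $ 1 + a $ 2 * d $ 2 = 0" by (simp add: inner_vec_def sum_2)
  have t: "t * (d \<bullet> d) = a $ 2 * d $ 1 - a $ 1 * d $ 2" using dd by (simp add: t_def)
  have "(a $ 1 + t * d $ 2) * (d \<bullet> d) = a $ 1 * (d \<bullet> d) + t * (d \<bullet> d) * d $ 2"
    by (simp add: algebra_simps)
  also have "\<dots> = d $ 1 * (a $ 1 * d $ 1 + a $ 2 * d $ 2)"
    unfolding t by (simp add: inner_vec_def sum_2 algebra_simps)
  also have "\<dots> = 0" by (simp only: orth mult_zero_right)
  finally have "a $ 1 + t * d $ 2 = 0" using dd by (simp only: mult_eq_0_iff) blast
  then have a1: "a $ 1 = - t * d $ 2" by linarith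
  have "(a $ 2 - t * d $ 1) * (d \<bullet> d) = a $ 2 * (d \<bullet> d) - t * (d \<bullet> d) * d $ 1"
    by (simp add: algebra_simps)
  also have "\<dots> = d $ 2 * (a $ 1 * d $ 1 + a $ 2 * d $ 2)"
    unfolding t by (simp add: inner_vec_def sum_2 algebra_simps)
  also have "\<dots> = 0" by (simp only: orth mult_zero_right)
  finally have "a $ 2 - t * d $ 1 = 0" using dd by (simp only: mult_eq_0_iff) blast
  then have a2: "a $ 2 = t * d $ 1" by linarith
  have "t \<noteq> 0" using a1 a2 a(1) by (auto simp: vec_eq_iff forall_2)
  have "t * side x \<le> 0" if "x \<in> P" for x
  proof -
    have "a \<bullet> (x - A) \<le> 0" using a(2) that AB by (auto simp: inner_diff_right)
    moreover have "a \<bullet> (x - A) = t * side x"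
      by (simp add: side_def inner_vec_def sum_2 a1 a2 flip: d_def) (simp add: algebra_simps)
    ultimately show ?thesis by simp
  qed
  then have "0 \<le> (t * side p) * (t * side q)" using pq by (intro mult_nonpos_nonpos)
  also have "\<dots> = t\<^sup>2 * (side p * side q)" by (simp add: power2_eq_square algebra_simps)
  finally show ?thesis using \<open>t \<noteq> 0\<close> by (simp add: zero_le_mult_iff)
qed

text \<open>Each side is counted at least once on the right.\<close>

lemma perimeter_le_sum:
  assumes "finite I" and "\<And>e. e edge_of P \<Longrightarrow> \<exists>i\<in>I. e = closed_segment (a i) (b i)"
  shows "perimeter P \<le> (\<Sum>i\<in>I. dist (a i) (b i))"
proof -
  have "perimeter P \<le> (\<Sum>e\<in>(\<lambda>i. closed_segment (a i) (b i)) ` I. diameter e)"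
    unfolding perimeter_def using assms
    by (intro sum_mono2) (auto simp: diameter_segment)
  also have "\<dots> \<le> (\<Sum>i\<in>I. diameter (closed_segment (a i) (b i)))"
    using assms(1) by (intro order_trans[OF sum_image_le]) (auto simp: diameter_segment)
  finally show ?thesis by (simp add: diameter_segment)
qed

lemma perimeter_triangle_le: "perimeter (convex hull {A, B, C}) \<le> dist A B + dist B C + dist C A"
proof -
  let ?P = "convex hull {A, B, C}"
  have poly: "polytope ?P" by (intro polytope_convex_hull) simp
  let ?a = "(!) [A, B, C]" and ?b = "(!) [B, C, A]"
  have "perimeter ?P \<le> (\<Sum>i\<in>{0, 1, 2}. dist (?a i) (?b i))"
  proof (rule perimeter_le_sum)
    fix e assume "e edge_of ?P"
    then obtain X Y where XY: "e = closed_segment X Y" "X \<noteq> Y" "X \<in> vertices ?P" "Y \<in> vertices ?P"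
      using edge_is_segment[OF poly] by blast
    moreover have "vertices ?P \<subseteq> {A, B, C}"
      by (auto simp: vertices_def dest: extreme_point_of_convex_hull)
    ultimately show "\<exists>i\<in>{0, 1, 2}. e = closed_segment (?a i) (?b i)"
      by (auto simp: closed_segment_commute)
  qed simp
  then show ?thesis by simp
qed

lemma dist_dir: "dist (dir a) (dir b) = 2 * \<bar>sin ((a - b) / 2)\<bar>"
proof -
  have "2 * ((a - b) / 2) = a - b" by simp
  then have half: "cos (a - b) = 1 - 2 * (sin ((a - b) / 2))\<^sup>2" using cos_double_sin by metis
  have "(dist (dir a) (dir b))\<^sup>2 = 2 - 2 * cos (a - b)"
    by (simp add: dist_norm power2_norm_eq_inner inner_diff_left inner_diff_right inner_dir_dir
        cos_diff[of b a] cos_diff[of a b])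
  also have "\<dots> = (2 * sin ((a - b) / 2))\<^sup>2"
    using half by (simp add: power_mult_distrib)
  finally have "dist (dir a) (dir b) = \<bar>2 * sin ((a - b) / 2)\<bar>"
    by (metis abs_of_nonneg real_sqrt_abs zero_le_dist)
  then show ?thesis by (simp add: abs_mult)
qed

lemma dist_dir_le: "dist (dir a) (dir b) \<le> \<bar>a - b\<bar>"
  using abs_sin_x_le_abs_x[of "(a - b) / 2"] by (simp add: dist_dir)

lemma dist_dir_60_degrees: "dist (dir a) (dir (a + pi / 3)) = 1"
  by (simp add: dist_dir sin_30)

lemma dist_dir_le_1: 
  assumes "a \<le> b" "b \<le> a + pi / 3"
  shows "dist (dir a) (dir b) \<le> 1"
proof -
  have "sin ((b - a) / 2) \<le> sin (pi / 6)" "0 \<le> sin ((b - a) / 2)"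
    using assms by (auto intro!: sin_monotone_2pi_le sin_ge_zero)
  then show ?thesis by (subst dist_commute) (simp add: dist_dir sin_30)
qed

section \<open>Polygons inscribed in a sector of sixty degrees\<close>

text \<open>The vertices are the centre 0 of the unit circle and \<open>m + 2\<close> points on an arc of sixty degrees, ends
included. The centre is an apex for every chord of the arc, and the two ends of the arc together with
the centre form a regular triangle, so each end is an apex for the radius to the other end. When all
arc points but the last crowd at the beginning of the arc, the polygon is close to this triangle.\<close>

locale sector_polygon =
  fixes \<phi> :: "nat \<Rightarrow> real" and m :: nat
  assumes phi_mono: "\<And>i j. i < j \<Longrightarrow> j \<le> Suc m \<Longrightarrow> \<phi> i < \<phi> j"
    and phi_0: "\<phi> 0 = 0" and phi_last: "\<phi> (Suc m) = pi / 3"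
begin

definition arc_points :: "plane set" where
  "arc_points = (\<lambda>j. dir (\<phi> j)) ` {..Suc m}"

definition sector :: "plane set" where
  "sector = convex hull (insert 0 arc_points)"

lemma phi_range:
  assumes "j \<le> Suc m"
  shows "0 \<le> \<phi> j \<and> \<phi> j \<le> pi / 3"
proof -
  have "0 \<le> \<phi> j" using phi_mono[of 0 j] assms phi_0 by (cases "j = 0") auto
  moreover have "\<phi> j \<le> \<phi> (Suc m)" using phi_mono[of j "Suc m"] assms by (cases "j = Suc m") auto
  ultimately show ?thesis by (simp add: phi_last)
qed

lemma polytope_sector: "polytope sector"
  unfolding sector_def arc_points_def by (intro polytope_convex_hull) auto

lemma arc_point_in_sector: "j \<le> Suc m \<Longrightarrow> dir (\<phi> j) \<in> sector"
  by (auto simp: sector_def arc_points_def intro!: hull_inc)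

lemma zero_in_sector: "0 \<in> sector"
  by (auto simp: sector_def intro!: hull_inc)

text \<open>An arc point is extreme because the tangent of the circle touches the unit disc only there. The centre
is extreme because a line orthogonal to the bisector of the sector separates it from the arc points.\<close>

lemma vertices_sector: "vertices sector = insert 0 arc_points"
proof
  show "vertices sector \<subseteq> insert 0 arc_points"
    unfolding vertices_def sector_def by (auto dest: extreme_point_of_convex_hull)
  have "0 \<notin> convex hull arc_points"
  proof -
    have "convex hull arc_points \<subseteq> {p. dir (pi / 6) \<bullet> p \<ge> cos (pi / 6)}"
    proof (intro hull_minimal convex_halfspace_ge subsetI CollectI)
      fix p assume "p \<in> arc_points"
      then obtain j where j: "j \<le> Suc m" "p = dir (\<phi> j)" by (auto simp: arc_points_def)
      have "\<bar>pi / 6 - \<phi> j\<bar> \<le> pi / 6" using phi_range[OF j(1)] by (intro abs_leI) auto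
      then have "cos (pi / 6) \<le> cos \<bar>pi / 6 - \<phi> j\<bar>" by (intro cos_monotone_0_pi_le) auto
      then show "cos (pi / 6) \<le> dir (pi / 6) \<bullet> p" by (simp add: j inner_dir_dir)
    qed
    moreover have "0 < cos (pi / 6)" by (simp add: cos_30)
    ultimately show ?thesis by force
  qed
  then have "0 extreme_point_of sector"
    unfolding sector_def by (intro extreme_point_of_convex_hull_insert) (simp_all add: arc_points_def)
  moreover have "dir (\<phi> j) extreme_point_of sector" if "j \<le> Suc m" for j
  proof -
    let ?u = "dir (\<phi> j)"
    have "sector \<subseteq> cball 0 1"
      unfolding sector_def by (intro hull_minimal) (auto simp: arc_points_def)
    then have small: "norm p \<le> 1" if "p \<in> sector" for p using that by auto
    have le: "?u \<bullet> p \<le> 1" if "p \<in> sector" for p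
      using norm_cauchy_schwarz[of ?u p] small[OF that] by simp
    have "p = ?u" if "p \<in> sector" "?u \<bullet> p = 1" for p
    proof -
      have "(norm (p - ?u))\<^sup>2 = (norm p)\<^sup>2 - 1"
        using that(2) by (simp add: power2_norm_eq_inner inner_diff_left inner_diff_right
            inner_commute[of p ?u] inner_dir_dir)
      also have "\<dots> \<le> 0" using small[OF that(1)] by (simp add: power_le_one)
      finally show ?thesis by simp
    qed
    moreover have "?u \<bullet> ?u = 1" by (simp add: inner_dir_dir)
    ultimately have "sector \<inter> {p. ?u \<bullet> p = 1} = {?u}"
      using arc_point_in_sector[OF that] by blast
    then show ?thesis using le by (rule extreme_point_of_Int_supporting_hyperplane_le)
  qed
  ultimately show "insert 0 arc_points \<subseteq> vertices sector"
    by (auto simp: vertices_def arc_points_def)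
qed

lemma card_vertices_sector: "card (vertices sector) = m + 3"
proof -
  have "inj_on (\<lambda>j. dir (\<phi> j)) {..Suc m}"
  proof (rule inj_onI, rule ccontr)
    fix i j assume ij: "i \<in> {..Suc m}" "j \<in> {..Suc m}" "dir (\<phi> i) = dir (\<phi> j)" "i \<noteq> j"
    then have "\<phi> i \<noteq> \<phi> j" by (metis atMost_iff less_irrefl linorder_neqE_nat phi_mono)
    then show False
      using inj_on_dir[of pi 0] ij phi_range[of i] phi_range[of j] by (auto simp: inj_on_def)
  qed
  then have "card arc_points = m + 2" by (simp add: arc_points_def card_image)
  moreover have "0 \<notin> arc_points"
    using dir_nonzero by (metis arc_points_def imageE)
  moreover have "finite arc_points" by (simp add: arc_points_def)
  ultimately show ?thesis by (simp add: vertices_sector)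
qed

lemma interior_sector: "interior sector \<noteq> {}"
  by (rule interior_nonempty_if_three_vertices[OF polytope_sector]) (simp add: card_vertices_sector)

text \<open>The line through 0 and an inner arc point separates the two ends of the arc.\<close>

lemma radius_not_edge:
  assumes "0 < j" "j < Suc m"
  shows "\<not> closed_segment 0 (dir (\<phi> j)) edge_of sector"
proof
  assume "closed_segment 0 (dir (\<phi> j)) edge_of sector"
  from edge_on_one_side[OF polytope_sector interior_sector this
      arc_point_in_sector[of 0] arc_point_in_sector[of "Suc m"]]
  have "0 \<le> sin (0 - \<phi> j) * sin (pi / 3 - \<phi> j)"
    by (simp add: dir_def phi_0 phi_last sin_diff mult.commute)
  moreover have "0 < \<phi> j" "\<phi> j < pi / 3"
    using phi_mono[of 0 j] phi_mono[of j "Suc m"] assms phi_0 phi_last by auto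
  then have "sin (\<phi> j) > 0" "sin (pi / 3 - \<phi> j) > 0" by (auto intro!: sin_gt_zero)
  ultimately show False by (simp add: mult_le_0_iff)
qed

text \<open>The chord separates the arc points between its ends from the centre.\<close>

lemma long_chord_not_edge:
  assumes "i < j" "j < k" "k \<le> Suc m"
  shows "\<not> closed_segment (dir (\<phi> i)) (dir (\<phi> k)) edge_of sector"
proof
  assume edge: "closed_segment (dir (\<phi> i)) (dir (\<phi> k)) edge_of sector"
  define x where "x = \<phi> j - \<phi> i"
  define y where "y = \<phi> k - \<phi> j"
  have xy: "0 < x" "0 < y" "x + y \<le> pi / 3"
    using phi_mono[of i j] phi_mono[of j k] phi_range[of i] phi_range[of k] assms
    by (auto simp: x_def y_def)
  have "0 \<le> sin (\<phi> k - \<phi> i) * (sin (\<phi> k - \<phi> i) - sin (\<phi> k - \<phi> j) - sin (\<phi> j - \<phi> i))"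
    using edge_on_one_side[OF polytope_sector interior_sector edge
      zero_in_sector arc_point_in_sector[of j]] assms
    by (simp add: dir_def sin_diff algebra_simps)
  then have "0 \<le> sin (x + y) * (sin (x + y) - sin y - sin x)" by (simp add: x_def y_def)
  moreover have "0 < sin (x + y)" "0 < sin x" "0 < sin y" using xy by (auto intro!: sin_gt_zero)
  ultimately have "sin x + sin y \<le> sin (x + y)" by (simp add: zero_le_mult_iff)
  moreover have "cos x < 1" "cos y < 1"
    using cos_monotone_0_pi[of 0 x] cos_monotone_0_pi[of 0 y] xy by auto
  then have "sin x * cos y < sin x * 1" "cos x * sin y < 1 * sin y"
    using \<open>0 < sin x\<close> \<open>0 < sin y\<close> by auto
  ultimately show False by (simp add: sin_add)
qed

lemma edge_of_sector_cases:
  assumes "e edge_of sector"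
  obtains j where "j \<in> {0, Suc m}" "e = closed_segment 0 (dir (\<phi> j))"
    | j where "j \<le> m" "e = closed_segment (dir (\<phi> j)) (dir (\<phi> (Suc j)))"
proof -
  note goal_radius = that(1) and goal_chord = that(2)
  obtain A B where AB: "e = closed_segment A B" "A \<noteq> B" "A \<in> insert 0 arc_points" "B \<in> insert 0 arc_points"
    using edge_is_segment[OF polytope_sector assms] vertices_sector by metis
  have radius: thesis if j: "j \<le> Suc m" "e = closed_segment 0 (dir (\<phi> j))" for j
  proof (rule goal_radius[OF _ j(2)])
    have "\<not> (0 < j \<and> j < Suc m)" using radius_not_edge[of j] assms j(2) by metis
    then show "j \<in> {0, Suc m}" using j(1) by auto
  qed
  have chord: thesis
    if ik: "i < k" "k \<le> Suc m" "e = closed_segment (dir (\<phi> i)) (dir (\<phi> k))" for i k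
  proof (rule goal_chord)
    have "\<not> Suc i < k" using long_chord_not_edge[of i "Suc i" k] ik assms by blast
    then have "k = Suc i" using ik(1) by simp
    then show "i \<le> m" "e = closed_segment (dir (\<phi> i)) (dir (\<phi> (Suc i)))" using ik by auto
  qed
  show thesis
  proof (cases "A = 0 \<or> B = 0")
    case True
    then have "\<exists>X\<in>arc_points. e = closed_segment 0 X"
      using AB closed_segment_commute[of A B] by auto
    then obtain j where "j \<le> Suc m" "e = closed_segment 0 (dir (\<phi> j))"
      unfolding arc_points_def by blast
    then show thesis by (rule radius)
  next
    case False
    then obtain i k where ik: "i \<le> Suc m" "k \<le> Suc m" "A = dir (\<phi> i)" "B = dir (\<phi> k)"
      using AB by (auto simp: arc_points_def)
    then have "i \<noteq> k" using AB by auto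
    then consider "i < k" | "k < i" by linarith
    then show thesis
      using chord[of i k] chord[of k i] ik AB(1) closed_segment_commute[of A B] by cases simp_all
  qed
qed

lemma Delta_property_sector: "Delta_property sector"
  unfolding Delta_property_def side_endpoints_def
proof (intro allI impI)
  fix A B assume edge: "closed_segment A B edge_of sector"
  show "\<exists>C\<in>sector. dist A C = 1 \<and> dist B C = 1"
    using edge
  proof (cases rule: edge_of_sector_cases)
    case (1 j)
    then have AB: "{A, B} = {0, dir (\<phi> j)}" by (simp add: closed_segment_eq)
    have "dist (dir (\<phi> 0)) (dir (\<phi> (Suc m))) = 1"
      using dist_dir_60_degrees[of 0] by (simp add: phi_0 phi_last)
    then have "dist (dir (\<phi> j)) (dir (\<phi> (Suc m - j))) = 1" using 1(1) by (auto simp: dist_commute)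
    then show ?thesis
      using AB arc_point_in_sector[of "Suc m - j"]
      by (intro bexI[of _ "dir (\<phi> (Suc m - j))"]) (auto simp: doubleton_eq_iff)
  next
    case (2 j)
    then have "{A, B} = {dir (\<phi> j), dir (\<phi> (Suc j))}" by (simp add: closed_segment_eq)
    then show ?thesis using zero_in_sector by (intro bexI[of _ 0]) (auto simp: doubleton_eq_iff)
  qed
qed

text \<open>The two radii contribute 2, the last chord at most 1, and the other chords together at most the length
\<open>\<phi> m\<close> of the arc that they subtend.\<close>

lemma perimeter_sector_le: "perimeter sector \<le> 3 + \<phi> m"
proof -
  let ?s = "\<lambda>i. case i of Inl j \<Rightarrow> 0 | Inr j \<Rightarrow> dir (\<phi> j)"
  let ?t = "\<lambda>i. case i of Inl j \<Rightarrow> dir (\<phi> j) | Inr j \<Rightarrow> dir (\<phi> (Suc j))"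
  have "perimeter sector \<le> (\<Sum>i\<in>{0, Suc m} <+> {..m}. dist (?s i) (?t i))"
  proof (rule perimeter_le_sum)
    fix e assume "e edge_of sector"
    then show "\<exists>i\<in>{0, Suc m} <+> {..m}. e = closed_segment (?s i) (?t i)"
      by (cases rule: edge_of_sector_cases) (force simp: Plus_def)+
  qed simp
  also have "\<dots> = 2 + (\<Sum>j\<le>m. dist (dir (\<phi> j)) (dir (\<phi> (Suc j))))"
    by (simp add: sum.Plus)
  also have "(\<Sum>j\<le>m. dist (dir (\<phi> j)) (dir (\<phi> (Suc j))))
      = (\<Sum>j<m. dist (dir (\<phi> j)) (dir (\<phi> (Suc j)))) + dist (dir (\<phi> m)) (dir (\<phi> (Suc m)))"
    by (simp flip: lessThan_Suc_atMost)
  also have "(\<Sum>j<m. dist (dir (\<phi> j)) (dir (\<phi> (Suc j)))) \<le> (\<Sum>j<m. \<phi> (Suc j) - \<phi> j)"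
  proof (rule sum_mono)
    fix j assume "j \<in> {..<m}"
    then show "dist (dir (\<phi> j)) (dir (\<phi> (Suc j))) \<le> \<phi> (Suc j) - \<phi> j"
      using dist_dir_le[of "\<phi> j" "\<phi> (Suc j)"] phi_mono[of j "Suc j"] by auto
  qed
  also have "(\<Sum>j<m. \<phi> (Suc j) - \<phi> j) = \<phi> m" by (simp add: sum_lessThan_telescope phi_0)
  also have "dist (dir (\<phi> m)) (dir (\<phi> (Suc m))) \<le> 1"
    using phi_range[of m] phi_last by (intro dist_dir_le_1) auto
  finally show ?thesis by simp
qed

end

lemma near_minimal_polygon:
  assumes "n \<ge> 3" "\<epsilon> > 0"
  obtains P where "convex_polygon P" "card (vertices P) = n" "Delta_property P" "perimeter P < 3 + \<epsilon>"
proof -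
  define m where "m = n - 3"
  define \<delta> where "\<delta> = min (\<epsilon> / 2) (pi / 6)"
  have \<delta>: "0 < \<delta>" "\<delta> < \<epsilon>" "\<delta> < pi / 3" using assms(2) by (auto simp: \<delta>_def min_def)
  \<comment> \<open>The \<open>m + 1\<close> points before the last one lie within the angle \<open>\<delta>\<close> of the first one.\<close>
  define \<phi> where "\<phi> j = (if j \<le> m then \<delta> * (real j / real (Suc m)) else pi / 3)" for j
  have small: "\<phi> j < \<delta>" if "j \<le> m" for j
    using that \<delta>(1) mult_strict_left_mono[of "real j / real (Suc m)" 1 \<delta>] by (simp add: \<phi>_def)
  interpret sector_polygon \<phi> m
  proof
    fix i j assume ij: "i < j" "j \<le> Suc m"
    show "\<phi> i < \<phi> j"
    proof (cases "j \<le> m")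
      case True
      then show ?thesis using ij \<delta>(1) by (simp add: \<phi>_def divide_strict_right_mono)
    next
      case False
      then have "\<phi> j = pi / 3" by (simp add: \<phi>_def)
      moreover have "\<phi> i < \<delta>" using small ij by simp
      ultimately show ?thesis using \<delta>(3) by simp
    qed
  qed (auto simp: \<phi>_def)
  show thesis
  proof (rule that)
    show "card (vertices sector) = n" using card_vertices_sector assms(1) by (simp add: m_def)
    show "perimeter sector < 3 + \<epsilon>" using perimeter_sector_le small[of m] \<delta>(2) by simp
  qed (rule polytope_sector Delta_property_sector)+
qed

section \<open>The minimal perimeter\<close>

lemma perimeter_unit_regular_triangle_le:
  assumes "unit_regular_triangle P"
  shows "perimeter P \<le> 3"
proof -
  obtain A B C where "P = convex hull {A, B, C}" "dist A B = 1" "dist B C = 1" "dist C A = 1"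
    using assms unfolding unit_regular_triangle_def by blast
  then show ?thesis using perimeter_triangle_le[of A B C] by simp
qed

theorem theorem1:
  fixes n :: nat
  assumes "n \<ge> 3"
  shows "(\<forall>P. convex_polygon P \<and> card (vertices P) = n \<and> Delta_property P
              \<longrightarrow> perimeter P \<ge> 3)
       \<and> (\<forall>\<epsilon>>0. \<exists>P. convex_polygon P \<and> card (vertices P) = n \<and> Delta_property P
              \<and> perimeter P < 3 + \<epsilon>)
       \<and> (\<forall>P. convex_polygon P \<and> card (vertices P) = n \<and> Delta_property P
              \<longrightarrow> (perimeter P = 3 \<longleftrightarrow> unit_regular_triangle P))"
proof (intro conjI allI impI)
  show "3 \<le> perimeter P" if "convex_polygon P \<and> card (vertices P) = n \<and> Delta_property P" for P
    using that Delta_perimeter(1)[of P] assms by blast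
next
  show "\<exists>P. convex_polygon P \<and> card (vertices P) = n \<and> Delta_property P \<and> perimeter P < 3 + \<epsilon>"
    if "0 < \<epsilon>" for \<epsilon> :: real
    using near_minimal_polygon[OF assms that] by metis
next
  fix P
  assume "convex_polygon P \<and> card (vertices P) = n \<and> Delta_property P"
  then have P: "convex_polygon P" "card (vertices P) \<ge> 3" "Delta_property P" using assms by auto
  show "perimeter P = 3 \<longleftrightarrow> unit_regular_triangle P"
    using Delta_perimeter[OF P] perimeter_unit_regular_triangle_le[of P] by fastforce
qed

end
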